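(* Let $1\le k\le M$ and $x>0$. Let $X_{i^*}$ be the $k$-th largest among $X_1,\dots,X_M$ (SNR-based selection, SBS) and $\Pi^{(k)}_{\rm SBS}(x)=\mathbb P\{X_{i^*}\le x\}$. With all other parameters fixed, $$\lim_{P_t\to\infty}\Pi^{(k)}_{\rm SBS}(x)=I_{F^\infty(x)}(M-k+1,k),\qquad F^\infty(x)=1-\exp\left(-\frac{\sigma_n^2ct_2x}{t_1(ac-b)}\right),$$ where $I_\psi(p,q)=\frac1{B(p,q)}\int_0^\psi t^{p-1}(1-t)^{q-1}\,dt$ is the normalized incomplete beta function.
   Context: There are $M\ge 1$ devices. The channel gains $|g_1|^2,\dots,|g_M|^2,|h_1|^2,\dots,|h_M|^2$ are independent exponential random variables with mean $1$. Parameters: $P_t>0$, $\sigma_n^2>0$, $0<t_1<1$, $t_2=1-t_1$, and real constants $a,b,c$ with $c>0$ and $ac-b>0$. The energy harvested by device $i$ is $E_i=t_1\left(\frac{aP_t|g_i|^2+b}{P_t|g_i|^2+c}-\frac bc\right)$, and the SNR of device $i$ is $X_i=\frac{|h_i|^2}{t_2\sigma_n^2}E_i$. $B$ is the beta function. *)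

theory Defs
  imports "HOL-Probability.Probability"
begin

definition harvested_energy ::
    "real \<Rightarrow> real \<Rightarrow> real \<Rightarrow> real \<Rightarrow> real \<Rightarrow> complex \<Rightarrow> real" where
  "harvested_energy t1 a b c Pt g =
     t1 * ((a * Pt * (cmod g)\<^sup>2 + b) / (Pt * (cmod g)\<^sup>2 + c) - b / c)"

definition snr ::
    "real \<Rightarrow> real \<Rightarrow> real \<Rightarrow> real \<Rightarrow> real \<Rightarrow> real \<Rightarrow> real \<Rightarrow> complex \<Rightarrow> complex \<Rightarrow> real" where
  "snr \<sigma> t1 t2 a b c Pt g h =
     (cmod h)\<^sup>2 / (t2 * \<sigma>\<^sup>2) * harvested_energy t1 a b c Pt g"

text \<open>Counted with multiplicity, with \<open>k = 1\<close> giving the maximum;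
  only meaningful for \<open>1 \<le> k \<le> length xs\<close>.\<close>

definition kth_largest :: "nat \<Rightarrow> real list \<Rightarrow> real" where
  "kth_largest k xs = rev (sort xs) ! (k - 1)"

definition sbs_outage ::
    "'w measure \<Rightarrow> nat \<Rightarrow> (nat \<Rightarrow> 'w \<Rightarrow> complex) \<Rightarrow> (nat \<Rightarrow> 'w \<Rightarrow> complex) \<Rightarrow>
     real \<Rightarrow> real \<Rightarrow> real \<Rightarrow> real \<Rightarrow> real \<Rightarrow> real \<Rightarrow> nat \<Rightarrow> real \<Rightarrow> real \<Rightarrow> real" where
  "sbs_outage \<Omega> M g h \<sigma> t1 t2 a b c k x Pt =
     measure \<Omega> {\<omega> \<in> space \<Omega>.
       kth_largest k (map (\<lambda>i. snr \<sigma> t1 t2 a b c Pt (g i \<omega>) (h i \<omega>)) [1..<M+1]) \<le> x}"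

definition reg_inc_beta :: "real \<Rightarrow> real \<Rightarrow> real \<Rightarrow> real" where
  "reg_inc_beta \<psi> p q =
     1 / Beta p q * integral {0..\<psi>} (\<lambda>t. t powr (p - 1) * (1 - t) powr (q - 1))"

end

theory Submission
  imports Defs "HOL-Real_Asymp.Real_Asymp"
begin

text \<open>At most \<open>k - 1\<close> devices have SNR above \<open>x\<close> iff at least \<open>M - k + 1\<close> have SNR at most \<open>x\<close>. As the
  transmit power grows, each SNR converges almost surely to a constant multiple of \<open>|h\<^sub>i|\<^sup>2\<close>, which
  equals \<open>x\<close> with probability \<open>0\<close>; so the outage event stabilises almost surely and dominated
  convergence reduces the limit to counting independent events \<open>|h\<^sub>i|\<^sup>2 \<le> y\<close>. The resulting binomial
  tail, as a function of the success probability, has a telescoping derivative, which is the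
  integrand of the incomplete beta function.\<close>

section \<open>Order statistics\<close>

text \<open>Sorting makes the entries at most \<open>x\<close> an initial segment, so an index lies
  in that segment exactly when it is below the segment's length.\<close>

lemma sorted_nth_le_iff:
  fixes xs :: "'a::linorder list"
  assumes "sorted xs" "i < length xs"
  shows "xs ! i \<le> x \<longleftrightarrow> i < length (filter (\<lambda>y. y \<le> x) xs)"
  using assms
proof (induction xs arbitrary: i)
  case (Cons z zs)
  show ?case
  proof (cases "z \<le> x")
    case True
    then show ?thesis using Cons by (cases i) auto
  next
    case False
    then have "filter (\<lambda>y. y \<le> x) (z # zs) = []"
      using Cons.prems by (auto simp: filter_empty_conv)
    moreover have "z \<le> (z # zs) ! i"
      using Cons.prems by (cases i) auto
    ultimately show ?thesis using False by auto
  qed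
qed simp

text \<open>Position \<open>k - 1\<close> from the top is position \<open>length xs - k\<close> from
  the bottom, and sorting preserves the number of entries at most \<open>x\<close>.\<close>

lemma kth_largest_le_iff:
  assumes "1 \<le> k" "k \<le> length xs"
  shows "kth_largest k xs \<le> x \<longleftrightarrow> length xs - k < length (filter (\<lambda>y. y \<le> x) xs)"
proof -
  have "kth_largest k xs = sort xs ! (length xs - k)"
    using assms by (simp add: kth_largest_def rev_nth)
  moreover have "length (filter (\<lambda>y. y \<le> x) (sort xs)) = length (filter (\<lambda>y. y \<le> x) xs)"
    by (simp add: filter_sort)
  ultimately show ?thesis
    using sorted_nth_le_iff[of "sort xs" "length xs - k" x] assms by simp
qed

lemma kth_largest_map_le_iff:
  assumes "1 \<le> k" "k \<le> M"
  shows "kth_largest k (map f [1..<M+1]) \<le> x \<longleftrightarrow> M - k + 1 \<le> card {i\<in>{1..M}. f i \<le> x}"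
proof -
  have "{i. f i \<le> x} \<inter> set [1..<M+1] = {i\<in>{1..M}. f i \<le> x}" by auto
  then have "length (filter (\<lambda>y. y \<le> x) (map f [1..<M+1])) = card {i\<in>{1..M}. f i \<le> x}"
    unfolding length_filter_map by (subst distinct_length_filter) (simp_all add: comp_def)
  then show ?thesis
    using assms by (subst kth_largest_le_iff) auto
qed

section \<open>Binomial tails and the incomplete beta function\<close>

text \<open>Each summand has a derivative with two parts, and neighbouring summands cancel;
  descending induction from \<open>m = n\<close>, where the tail is just \<open>p ^ n\<close>,
  leaves only the first part of the lowest summand.\<close>

lemma has_field_derivative_binomial_tail:
  fixes p :: real
  assumes "1 \<le> m" "m \<le> n"
  shows "((\<lambda>p. \<Sum>j=m..n. real (n choose j) * p ^ j * (1 - p) ^ (n - j)) has_field_derivative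
           real m * real (n choose m) * p ^ (m - 1) * (1 - p) ^ (n - m)) (at p)"
  using assms(2,1)
proof (induction m rule: inc_induct)
  case base
  then show ?case
    by (auto intro!: derivative_eq_intros)
next
  case (step m)
  \<comment> \<open>This identity equates the coefficient in the induction hypothesis with that of
    the negative part of the new summand's derivative, so the two cancel.\<close>
  have "Suc m * (n choose Suc m) = (n - m) * (n choose m)"
    by (simp only: binomial_absorption binomial_absorb_comp)
  then have *: "real (Suc m) * real (n choose Suc m) = real (n - m) * real (n choose m)"
    by (simp only: of_nat_mult [symmetric])
  have "(\<Sum>j=m..n. real (n choose j) * p ^ j * (1 - p) ^ (n - j)) =
        real (n choose m) * p ^ m * (1 - p) ^ (n - m) +
        (\<Sum>j=Suc m..n. real (n choose j) * p ^ j * (1 - p) ^ (n - j))" for p :: real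
    using step by (simp add: sum.atLeast_Suc_atMost)
  moreover have "((\<lambda>p. real (n choose m) * p ^ m * (1 - p) ^ (n - m)) has_field_derivative
      real m * real (n choose m) * p ^ (m - 1) * (1 - p) ^ (n - m)
      - real (n - m) * real (n choose m) * p ^ m * (1 - p) ^ (n - Suc m)) (at p)"
    by (auto intro!: derivative_eq_intros simp: algebra_simps)
  ultimately show ?case
    using DERIV_add[OF _ step.IH] * by (fastforce simp: algebra_simps)
qed

text \<open>Integrating the derivative of the tail from \<open>0\<close> to \<open>p\<close> gives
  the incomplete beta integral, up to the constant \<open>m * (n choose m)\<close>, which is the
  reciprocal of the beta function at these integer arguments.\<close>

lemma binomial_tail_eq_reg_inc_beta:
  assumes "1 \<le> m" "m \<le> n" "0 \<le> p" "p < 1"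
  shows "(\<Sum>j=m..n. real (n choose j) * p ^ j * (1 - p) ^ (n - j)) =
           reg_inc_beta p (real m) (real n - real m + 1)"
proof -
  define S where "S q = (\<Sum>j=m..n. real (n choose j) * q ^ j * (1 - q) ^ (n - j))" for q :: real
  define C where "C = real m * real (n choose m)"
  have C0: "C > 0" using assms by (simp add: C_def)
  have "((\<lambda>q. C * q ^ (m - 1) * (1 - q) ^ (n - m)) has_integral S p - S 0) {0..p}"
    using has_field_derivative_binomial_tail[OF assms(1,2)] assms(3)
    unfolding S_def C_def
    by (intro fundamental_theorem_of_calculus)
      (auto simp: has_real_derivative_iff_has_vector_derivative[symmetric]
        intro: has_field_derivative_at_within)
  then have "((\<lambda>q. (1/C) * (C * q ^ (m - 1) * (1 - q) ^ (n - m))) has_integral (1/C) * (S p - S 0)) {0..p}"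
    by (rule has_integral_mult_right)
  \<comment> \<open>Every exponent \<open>j\<close> is at least \<open>m\<close>, hence positive, so
    each summand vanishes at \<open>0\<close>.\<close>
  moreover have "S 0 = 0"
    unfolding S_def using assms by (intro sum.neutral) auto
  ultimately have "((\<lambda>q. q ^ (m - 1) * (1 - q) ^ (n - m)) has_integral S p / C) {0..p}"
    using C0 by (simp add: mult.assoc)
  \<comment> \<open>At \<open>q = 0\<close> and \<open>m = 1\<close> the two integrands differ, because \<open>0 powr 0 = 0\<close>.\<close>
  then have "((\<lambda>q. q powr (real m - 1) * (1 - q) powr (real n - real m + 1 - 1)) has_integral S p / C) {0..p}"
  proof (rule has_integral_spike[rotated 2])
    show "negligible {0::real}" by simp
    fix q assume "q \<in> {0..p} - {0}"
    then have "q > 0" "1 - q > 0" using assms by auto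
    then show "q powr (real m - 1) * (1 - q) powr (real n - real m + 1 - 1) = q ^ (m - 1) * (1 - q) ^ (n - m)"
      using assms by (simp add: powr_realpow[symmetric] of_nat_diff)
  qed
  then have int: "integral {0..p} (\<lambda>q. q powr (real m - 1) * (1 - q) powr (real n - real m + 1 - 1)) = S p / C"
    by (rule integral_unique)
  have "Beta (real m) (real n - real m + 1) = fact (m - 1) * fact (n - m) / fact n"
    using assms Gamma_fact[of "m - 1", where 'a = real] Gamma_fact[of "n - m", where 'a = real]
      Gamma_fact[of n, where 'a = real]
    by (simp add: Beta_def of_nat_diff add_ac)
  also have "\<dots> = 1 / C"
    using assms by (simp add: C_def binomial_fact fact_reduce[of m])
  finally show ?thesis
    using C0 unfolding reg_inc_beta_def int S_def by simp
qed

section \<open>Counting independent events\<close>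

lemma pred_card_ge:
  fixes m :: nat
  assumes "finite I" "\<And>i. i \<in> I \<Longrightarrow> Measurable.pred N (P i)"
  shows "Measurable.pred N (\<lambda>\<omega>. m \<le> card {i\<in>I. P i \<omega>})"
proof -
  have "card {i\<in>I. P i \<omega>} = (\<Sum>i\<in>I. if P i \<omega> then 1 else 0)" for \<omega>
    using assms(1) by (simp add: sum.If_cases Int_def)
  moreover have "(\<lambda>\<omega>. \<Sum>i\<in>I. if P i \<omega> then 1 else 0 :: nat) \<in> measurable N (count_space UNIV)"
    using assms(2) by measurable
  ultimately show ?thesis by simp
qed

context prob_space
begin

text \<open>Used to strip the \<open>Inr\<close> tags from the joint family of gains, so that the
  \<open>h\<close> gains are indexed by devices.\<close>

lemma indep_vars_reindex:
  assumes "indep_vars N X (f ` I)" "inj_on f I"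
  shows "indep_vars (\<lambda>i. N (f i)) (\<lambda>i. X (f i)) I"
  unfolding indep_vars_def2
proof (intro conjI ballI indep_setsI)
  let ?F = "\<lambda>i. {X i -` A \<inter> space M |A. A \<in> sets (N i)}"
  have X: "indep_sets ?F (f ` I)" and rv: "\<And>i. i \<in> I \<Longrightarrow> X (f i) \<in> measurable M (N (f i))"
    using assms(1) unfolding indep_vars_def2 by auto
  show "X (f i) \<in> measurable M (N (f i))" if "i \<in> I" for i using rv[OF that] .
  show "?F (f i) \<subseteq> events" if "i \<in> I" for i using rv[OF that] by auto
  fix A J assume J: "J \<noteq> {}" "J \<subseteq> I" "finite J" and A: "\<forall>j\<in>J. A j \<in> ?F (f j)"
  have inj: "inj_on f J" using assms(2) J(2) by (rule inj_on_subset)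
  let ?g = "the_inv_into J f"
  have g: "?g (f j) = j" if "j \<in> J" for j using the_inv_into_f_f[OF inj that] .
  have "prob (\<Inter>i\<in>f ` J. A (?g i)) = (\<Prod>i\<in>f ` J. prob (A (?g i)))"
    using J A g by (intro indep_setsD[OF X]) auto
  moreover have "(\<Inter>i\<in>f ` J. A (?g i)) = (\<Inter>j\<in>J. A j)" using g by auto
  ultimately show "prob (\<Inter>j\<in>J. A j) = (\<Prod>j\<in>J. prob (A j))"
    using g by (simp add: prod.reindex[OF inj])
qed

text \<open>Prescribing \<open>J\<close> fixes for every index whether \<open>A\<close> or its
  complement occurs, so independence turns the probability into a product of factors
  \<open>p\<close> and \<open>1 - p\<close>.\<close>

lemma prob_indep_exact:
  assumes X: "indep_vars (\<lambda>_. N) X I" and I: "finite I" "I \<noteq> {}" and A: "A \<in> sets N"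
    and p: "\<And>i. i \<in> I \<Longrightarrow> prob {\<omega> \<in> space M. X i \<omega> \<in> A} = p" and J: "J \<subseteq> I"
  shows "{\<omega> \<in> space M. {i\<in>I. X i \<omega> \<in> A} = J} \<in> events"
    and "prob {\<omega> \<in> space M. {i\<in>I. X i \<omega> \<in> A} = J} = p ^ card J * (1 - p) ^ (card I - card J)"
proof -
  define B where "B i = (if i \<in> J then A else space N - A)" for i
  have rv: "X i \<in> measurable M N" if "i \<in> I" for i
    using X that by (auto simp: indep_vars_def2)
  have B: "B i \<in> sets N" for i using A by (auto simp: B_def)
  have ev: "{\<omega> \<in> space M. X i \<omega> \<in> A} \<in> events" if "i \<in> I" for i
    using measurable_sets[OF rv[OF that] A] by (simp add: vimage_def Int_def conj_commute)
  \<comment> \<open>Nonemptiness of \<open>I\<close> matters here: an empty intersection would be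
    the whole type rather than \<open>space M\<close>.\<close>
  have eq: "{\<omega> \<in> space M. {i\<in>I. X i \<omega> \<in> A} = J} = (\<Inter>i\<in>I. X i -` B i \<inter> space M)"
    using J I(2) measurable_space[OF rv] by (auto simp: B_def split: if_splits)
  show "{\<omega> \<in> space M. {i\<in>I. X i \<omega> \<in> A} = J} \<in> events"
    unfolding eq using I B rv by (intro sets.finite_INT measurable_sets) auto
  have pB: "prob (X i -` B i \<inter> space M) = (if i \<in> J then p else 1 - p)" if i: "i \<in> I" for i
  proof (cases "i \<in> J")
    case True
    then have "X i -` B i \<inter> space M = {\<omega> \<in> space M. X i \<omega> \<in> A}" by (auto simp: B_def)
    then show ?thesis using p[OF i] True by simp
  next
    case False
    then have "X i -` B i \<inter> space M = space M - {\<omega> \<in> space M. X i \<omega> \<in> A}"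
      using measurable_space[OF rv[OF i]] by (auto simp: B_def)
    then show ?thesis using p[OF i] False prob_compl[OF ev[OF i]] by simp
  qed
  have "prob (\<Inter>i\<in>I. X i -` B i \<inter> space M) = (\<Prod>i\<in>I. if i \<in> J then p else 1 - p)"
    using indep_varsD_finite[OF X I(2,1) B] pB by simp
  also have "\<dots> = p ^ card J * (1 - p) ^ (card I - card J)"
    using I J by (simp add: prod.If_cases Int_absorb1 Diff_eq[symmetric] card_Diff_subset finite_subset)
  finally show "prob {\<omega> \<in> space M. {i\<in>I. X i \<omega> \<in> A} = J} = p ^ card J * (1 - p) ^ (card I - card J)"
    by (simp only: eq)
qed

text \<open>The event splits disjointly according to the exact index set \<open>J\<close>; grouping
  these sets by cardinality produces the binomial coefficients.\<close>

lemma prob_indep_count_ge: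
  fixes m :: nat
  assumes X: "indep_vars (\<lambda>_. N) X I" and I: "finite I" "I \<noteq> {}" and A: "A \<in> sets N"
    and p: "\<And>i. i \<in> I \<Longrightarrow> prob {\<omega> \<in> space M. X i \<omega> \<in> A} = p"
  shows "prob {\<omega> \<in> space M. m \<le> card {i\<in>I. X i \<omega> \<in> A}} =
           (\<Sum>j=m..card I. real (card I choose j) * p ^ j * (1 - p) ^ (card I - j))"
proof -
  let ?E = "\<lambda>J. {\<omega> \<in> space M. {i\<in>I. X i \<omega> \<in> A} = J}"
  let ?F = "\<lambda>j. {J. J \<subseteq> I \<and> card J = j}"
  let ?K = "{J. J \<subseteq> I \<and> m \<le> card J}"
  have finK: "finite ?K" using I by simp
  have "{\<omega> \<in> space M. m \<le> card {i\<in>I. X i \<omega> \<in> A}} = (\<Union>J\<in>?K. ?E J)" by auto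
  then have "prob {\<omega> \<in> space M. m \<le> card {i\<in>I. X i \<omega> \<in> A}} = (\<Sum>J\<in>?K. prob (?E J))"
    using finK prob_indep_exact(1)[OF X I A p]
    by (simp only:, intro finite_measure_finite_Union) (auto simp: disjoint_family_on_def)
  also have "\<dots> = (\<Sum>J\<in>?K. p ^ card J * (1 - p) ^ (card I - card J))"
    by (intro sum.cong refl prob_indep_exact(2)[OF X I A p]) auto
  also have "\<dots> = (\<Sum>j=m..card I. \<Sum>J\<in>{J\<in>?K. card J = j}. p ^ card J * (1 - p) ^ (card I - card J))"
    using finK I by (intro sum.group[symmetric]) (auto intro: card_mono)
  also have "\<dots> = (\<Sum>j=m..card I. real (card I choose j) * p ^ j * (1 - p) ^ (card I - j))"
  proof (intro sum.cong refl)
    fix j assume "j \<in> {m..card I}"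
    then have "{J\<in>?K. card J = j} = ?F j" by auto
    then have "(\<Sum>J\<in>{J\<in>?K. card J = j}. p ^ card J * (1 - p) ^ (card I - card J)) =
        (\<Sum>J\<in>?F j. p ^ j * (1 - p) ^ (card I - j))"
      by (intro sum.cong) auto
    then show "(\<Sum>J\<in>{J\<in>?K. card J = j}. p ^ card J * (1 - p) ^ (card I - card J)) =
        real (card I choose j) * p ^ j * (1 - p) ^ (card I - j)"
      using n_subsets[OF I(1)] by simp
  qed
  finally show ?thesis .
qed

text \<open>Almost surely the indicators are eventually constant in \<open>t\<close>, and the
  constant \<open>1\<close> dominates them.\<close>

lemma tendsto_prob_at_top:
  fixes Q :: "real \<Rightarrow> 'a \<Rightarrow> bool"
  assumes [measurable]: "\<And>t. Measurable.pred M (Q t)" "Measurable.pred M R"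
    and "AE \<omega> in M. eventually (\<lambda>t. Q t \<omega> \<longleftrightarrow> R \<omega>) at_top"
  shows "((\<lambda>t. prob {\<omega> \<in> space M. Q t \<omega>}) \<longlongrightarrow> prob {\<omega> \<in> space M. R \<omega>}) at_top"
proof -
  have "((\<lambda>t. integral\<^sup>L M (indicator {\<omega> \<in> space M. Q t \<omega>} :: _ \<Rightarrow> real)) \<longlongrightarrow>
      integral\<^sup>L M (indicator {\<omega> \<in> space M. R \<omega>})) at_top"
  proof (rule integral_dominated_convergence_at_top[where w = "\<lambda>_. 1"])
    show "AE \<omega> in M. ((\<lambda>t. indicator {\<omega> \<in> space M. Q t \<omega>} \<omega> :: real) \<longlongrightarrow>
        indicator {\<omega> \<in> space M. R \<omega>} \<omega>) at_top"
      using assms(3)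
    proof eventually_elim
      case (elim \<omega>)
      then show ?case
        by (intro tendsto_eventually) (auto elim!: eventually_mono simp: indicator_def)
    qed
  qed (auto simp: indicator_def)
  then show ?thesis by simp
qed

end

text \<open>A law with a Lebesgue density has no atoms.\<close>

lemma distributed_lborel_AE_neq:
  fixes X :: "'a \<Rightarrow> real"
  assumes "distributed M lborel X f"
  shows "AE \<omega> in M. X \<omega> \<noteq> y"
proof -
  have "AE z in density lborel f. z \<noteq> y"
    using distributed_borel_measurable[OF assms] AE_lborel_singleton[of y]
    by (subst AE_density) auto
  then have "AE z in distr M lborel X. z \<noteq> y"
    by (simp only: distributed_distr_eq_density[OF assms])
  then show ?thesis
    using distributed_measurable[OF assms] by (subst (asm) AE_distr_iff) auto
qed

section \<open>The limit of large transmit power\<close>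

text \<open>The harvested energy saturates at \<open>t1 * (a - b / c)\<close>. For
  \<open>g = 0\<close> it would instead be \<open>0\<close> at every power.\<close>

lemma tendsto_snr_at_top:
  assumes "c > 0" "g \<noteq> 0"
  shows "((\<lambda>Pt. snr \<sigma> t1 t2 a b c Pt g h) \<longlongrightarrow> (cmod h)\<^sup>2 / (t2 * \<sigma>\<^sup>2) * (t1 * (a - b / c))) at_top"
proof -
  define G where "G = (cmod g)\<^sup>2"
  have "G > 0" using assms by (simp add: G_def)
  then have "((\<lambda>Pt. (a * Pt * G + b) / (Pt * G + c)) \<longlongrightarrow> a) at_top"
    using assms by real_asymp
  then show ?thesis
    unfolding snr_def harvested_energy_def G_def by (intro tendsto_intros)
qed

theorem mainTheorem10:
  fixes \<Omega> :: "'w measure"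
    and g h :: "nat \<Rightarrow> 'w \<Rightarrow> complex"
    and M k :: nat
    and \<sigma> t1 t2 a b c x :: real
  assumes "prob_space \<Omega>"
    and "M \<ge> 1"
    and "\<And>i. i \<in> {1..M} \<Longrightarrow>
           distributed \<Omega> lborel (\<lambda>\<omega>. (cmod (g i \<omega>))\<^sup>2) (exponential_density 1)"
    and "\<And>i. i \<in> {1..M} \<Longrightarrow>
           distributed \<Omega> lborel (\<lambda>\<omega>. (cmod (h i \<omega>))\<^sup>2) (exponential_density 1)"
    and "prob_space.indep_vars \<Omega> (\<lambda>_. borel)
           (case_sum (\<lambda>i \<omega>. (cmod (g i \<omega>))\<^sup>2) (\<lambda>i \<omega>. (cmod (h i \<omega>))\<^sup>2))
           ({1..M} <+> {1..M})"
    and "\<sigma>\<^sup>2 > 0"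
    and "0 < t1" "t1 < 1" "t2 = 1 - t1"
    and "c > 0" "a * c - b > 0"
    and "1 \<le> k" "k \<le> M" "x > 0"
  shows "((\<lambda>Pt. sbs_outage \<Omega> M g h \<sigma> t1 t2 a b c k x Pt) \<longlongrightarrow>
           reg_inc_beta (1 - exp (- (\<sigma>\<^sup>2 * c * t2 * x / (t1 * (a * c - b)))))
             (real M - real k + 1) (real k)) at_top"
proof -
  interpret prob_space \<Omega> by fact
  define y where "y = \<sigma>\<^sup>2 * c * t2 * x / (t1 * (a * c - b))"
  define I where "I = {1..M}"
  have t2: "t2 > 0" using assms by simp
  have y0: "y > 0" unfolding y_def using assms t2 by simp
  \<comment> \<open>The limiting SNR is linear in the gain \<open>H\<close> with positive slope
    \<open>L\<close>, and \<open>y\<close> is the gain at which it reaches \<open>x\<close>.\<close>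
  have K: "H / (t2 * \<sigma>\<^sup>2) * (t1 * (a - b / c)) \<le> x \<longleftrightarrow> H \<le> y"
    "H / (t2 * \<sigma>\<^sup>2) * (t1 * (a - b / c)) = x \<longleftrightarrow> H = y" for H
  proof -
    define L where "L = t1 * (a * c - b) / (\<sigma>\<^sup>2 * c * t2)"
    have L: "L > 0" using assms t2 by (simp add: L_def)
    have "H / (t2 * \<sigma>\<^sup>2) * (t1 * (a - b / c)) = H * L"
      using assms t2 by (simp add: L_def field_simps)
    moreover have "x = y * L" using assms t2 by (simp add: y_def L_def)
    ultimately show "H / (t2 * \<sigma>\<^sup>2) * (t1 * (a - b / c)) \<le> x \<longleftrightarrow> H \<le> y"
      "H / (t2 * \<sigma>\<^sup>2) * (t1 * (a - b / c)) = x \<longleftrightarrow> H = y"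
      using L by simp_all
  qed
  have g_dist: "distributed \<Omega> lborel (\<lambda>\<omega>. (cmod (g i \<omega>))\<^sup>2) (exponential_density 1)"
    and h_dist: "distributed \<Omega> lborel (\<lambda>\<omega>. (cmod (h i \<omega>))\<^sup>2) (exponential_density 1)"
    if "i \<in> I" for i
    using that assms(3,4) by (auto simp: I_def)
  have g_meas: "(\<lambda>\<omega>. (cmod (g i \<omega>))\<^sup>2) \<in> borel_measurable \<Omega>"
    and h_meas: "(\<lambda>\<omega>. (cmod (h i \<omega>))\<^sup>2) \<in> borel_measurable \<Omega>" if "i \<in> I" for i
    using distributed_measurable[OF g_dist[OF that]] distributed_measurable[OF h_dist[OF that]]
    by simp_all
  have "indep_vars (\<lambda>_. borel) (\<lambda>i \<omega>. (cmod (h i \<omega>))\<^sup>2) I"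
  proof -
    have "indep_vars (\<lambda>_. borel)
        (case_sum (\<lambda>i \<omega>. (cmod (g i \<omega>))\<^sup>2) (\<lambda>i \<omega>. (cmod (h i \<omega>))\<^sup>2)) (Inr ` I)"
      using assms(5) by (rule indep_vars_subset) (auto simp: I_def)
    then show ?thesis
      by (auto dest: indep_vars_reindex)
  qed
  moreover have "prob {\<omega> \<in> space \<Omega>. (cmod (h i \<omega>))\<^sup>2 \<in> {..y}} = 1 - exp (- y)" if "i \<in> I" for i
    using exponential_distributedD_le[OF h_dist[OF that], of y] y0 by simp
  ultimately have "prob {\<omega> \<in> space \<Omega>. M - k + 1 \<le> card {i\<in>I. (cmod (h i \<omega>))\<^sup>2 \<in> {..y}}} =
      (\<Sum>j=M-k+1..card I. real (card I choose j) * (1 - exp (- y)) ^ j * (1 - (1 - exp (- y))) ^ (card I - j))"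
    using assms(2) by (intro prob_indep_count_ge) (auto simp: I_def)
  \<comment> \<open>The lower summation bound is \<open>m = M - k + 1\<close>, so the second beta
    parameter \<open>M - m + 1\<close> is \<open>k\<close>.\<close>
  also have "\<dots> = reg_inc_beta (1 - exp (- y)) (real (M - k + 1)) (real M - real (M - k + 1) + 1)"
    using assms y0 unfolding I_def card_atLeastAtMost diff_Suc_1
    by (intro binomial_tail_eq_reg_inc_beta) auto
  finally have lim: "prob {\<omega> \<in> space \<Omega>. M - k + 1 \<le> card {i\<in>I. (cmod (h i \<omega>))\<^sup>2 \<le> y}} =
      reg_inc_beta (1 - exp (- y)) (real M - real k + 1) (real k)"
    using assms by (simp add: of_nat_diff add.commute)
  have "((\<lambda>Pt. prob {\<omega> \<in> space \<Omega>. M - k + 1 \<le> card {i\<in>I. snr \<sigma> t1 t2 a b c Pt (g i \<omega>) (h i \<omega>) \<le> x}})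
      \<longlongrightarrow> prob {\<omega> \<in> space \<Omega>. M - k + 1 \<le> card {i\<in>I. (cmod (h i \<omega>))\<^sup>2 \<le> y}}) at_top"
  proof (rule tendsto_prob_at_top)
    show "Measurable.pred \<Omega> (\<lambda>\<omega>. M - k + 1 \<le> card {i\<in>I. snr \<sigma> t1 t2 a b c Pt (g i \<omega>) (h i \<omega>) \<le> x})" for Pt
    proof (rule pred_card_ge)
      fix i assume i: "i \<in> I"
      note [measurable] = g_meas[OF i] h_meas[OF i]
      show "Measurable.pred \<Omega> (\<lambda>\<omega>. snr \<sigma> t1 t2 a b c Pt (g i \<omega>) (h i \<omega>) \<le> x)"
        unfolding snr_def harvested_energy_def by measurable
    qed (simp add: I_def)
    show "Measurable.pred \<Omega> (\<lambda>\<omega>. M - k + 1 \<le> card {i\<in>I. (cmod (h i \<omega>))\<^sup>2 \<le> y})"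
    proof (rule pred_card_ge)
      fix i assume i: "i \<in> I"
      note [measurable] = h_meas[OF i]
      show "Measurable.pred \<Omega> (\<lambda>\<omega>. (cmod (h i \<omega>))\<^sup>2 \<le> y)" by measurable
    qed (simp add: I_def)
    \<comment> \<open>Two null events are discarded: a vanishing \<open>g\<close> gain, where the
      limit formula may fail, and a limiting SNR exactly at the threshold, where convergence would
      not decide the comparison.\<close>
    have "AE \<omega> in \<Omega>. \<forall>i\<in>I. (cmod (g i \<omega>))\<^sup>2 \<noteq> 0 \<and> (cmod (h i \<omega>))\<^sup>2 \<noteq> y"
      by (intro AE_finite_allI AE_conjI distributed_lborel_AE_neq[OF g_dist]
          distributed_lborel_AE_neq[OF h_dist]) (simp_all add: I_def)
    then show "AE \<omega> in \<Omega>. \<forall>\<^sub>F Pt in at_top.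
        (M - k + 1 \<le> card {i\<in>I. snr \<sigma> t1 t2 a b c Pt (g i \<omega>) (h i \<omega>) \<le> x}) \<longleftrightarrow>
        (M - k + 1 \<le> card {i\<in>I. (cmod (h i \<omega>))\<^sup>2 \<le> y})"
    proof eventually_elim
      case (elim \<omega>)
      have "\<forall>\<^sub>F Pt in at_top. snr \<sigma> t1 t2 a b c Pt (g i \<omega>) (h i \<omega>) \<le> x \<longleftrightarrow> (cmod (h i \<omega>))\<^sup>2 \<le> y"
        if i: "i \<in> I" for i
      proof -
        let ?l = "(cmod (h i \<omega>))\<^sup>2 / (t2 * \<sigma>\<^sup>2) * (t1 * (a - b / c))"
        have lim: "((\<lambda>Pt. snr \<sigma> t1 t2 a b c Pt (g i \<omega>) (h i \<omega>)) \<longlongrightarrow> ?l) at_top"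
          using elim i assms by (intro tendsto_snr_at_top) auto
        have "?l \<noteq> x" using elim i K(2) by auto
        then consider "?l < x" | "x < ?l" by linarith
        then show ?thesis
        proof cases
          case 1
          then show ?thesis
            using order_tendstoD(2)[OF lim 1] K(1)[of "(cmod (h i \<omega>))\<^sup>2"]
            by (auto elim!: eventually_mono)
        next
          case 2
          then show ?thesis
            using order_tendstoD(1)[OF lim 2] K(1)[of "(cmod (h i \<omega>))\<^sup>2"]
            by (auto elim!: eventually_mono)
        qed
      qed
      \<comment> \<open>Since there are finitely many devices, one power level works for all of
        them.\<close>
      then have "\<forall>\<^sub>F Pt in at_top. \<forall>i\<in>I.
          snr \<sigma> t1 t2 a b c Pt (g i \<omega>) (h i \<omega>) \<le> x \<longleftrightarrow> (cmod (h i \<omega>))\<^sup>2 \<le> y"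
        by (intro eventually_ball_finite) (auto simp: I_def)
      then show ?case
      proof eventually_elim
        case (elim Pt)
        then have "{i\<in>I. snr \<sigma> t1 t2 a b c Pt (g i \<omega>) (h i \<omega>) \<le> x} = {i\<in>I. (cmod (h i \<omega>))\<^sup>2 \<le> y}"
          by auto
        then show ?case by simp
      qed
    qed
  qed
  then show ?thesis
    unfolding lim unfolding sbs_outage_def kth_largest_map_le_iff[OF \<open>1 \<le> k\<close> \<open>k \<le> M\<close>] I_def y_def .
qed

end
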